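(* Let $\alpha\in(0,1]$, $\ell\ge0$, $\beta>0$ a constant, and $z_0\in\mathbb{R}^d$. Suppose that $f:\mathbb{R}^d\to\mathbb{R}$ is of class $C^2$ and there is a constant $m_f>0$ with $m_fI_d\preceq\nabla^2f(x)$ for all $x\in\mathbb{R}^d$, and let $y_*$ be the point with $\nabla f(y_* )=0$. Suppose that $\psi:[\ell,\infty)\to[0,\infty)$ is strictly increasing, of class $C^1$, with $\psi'>0$. Let $z$ be a solution of $${}^{C}D_{\ell,\psi}^{\alpha}z(t)=-\beta\nabla f(z(t))\quad(t\ge\ell),\qquad z(\ell)=z_0 .$$ Then: (1) The solution $z$ converges to $y_*$ with rate $$\|z(t)-y_*\|^2\le\|z_0-y_*\|^2\,\mathcal{E}_\alpha\big(-\beta m_f(\psi(t)-\psi(\ell))^{\alpha}\big)\quad\text{for all }t\ge\ell.$$ (2) If additionally there is $L_f>0$ with $\|\nabla f(x)-\nabla f(y)\|\le L_f\|x-y\|$ for all $x,y\in\mathbb{R}^d$, then $$f(z(t))-f(y_* )\le\tfrac12L_f\|z_0-y_*\|^2\,\mathcal{E}_\alpha\big(-\beta m_f(\psi(t)-\psi(\ell))^{\alpha}\big)\quad\text{for all }t\ge\ell.$$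
   Context: For $0<\gamma\le 1$, the $\psi$-Riemann-Liouville integral is $(I_{\ell,\psi}^{\gamma}x)(t)=\frac{1}{\Gamma(\gamma)}\int_\ell^t(\psi(t)-\psi(\tau))^{\gamma-1}\psi'(\tau)x(\tau)\,d\tau$, and $I_{\ell,\psi}^{0}$ is the identity. For $0<\alpha\le1$ the $\psi$-Caputo fractional derivative is ${}^{C}D_{\ell,\psi}^{\alpha}=I_{\ell,\psi}^{1-\alpha}\circ J_\psi$, where $J_\psi=\frac{1}{\psi'(t)}\frac{d}{dt}$. For vector-valued functions these are applied componentwise. A solution is a continuous function satisfying the equation for every $t\ge\ell$ together with the initial condition. The Mittag-Leffler function is $\mathcal{E}_\alpha(w)=\sum_{j\ge0}\frac{w^j}{\Gamma(j\alpha+1)}$. For symmetric matrices, $A\preceq B$ means $\langle Ax,x\rangle\le\langle Bx,x\rangle$ for all $x$. $\|\cdot\|$ is the Euclidean norm. *)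

theory Defs
  imports "HOL-Analysis.Analysis"
begin

definition mittag_leffler :: "real \<Rightarrow> real \<Rightarrow> real" where
  "mittag_leffler \<alpha> w = (\<Sum>j. w ^ j / Gamma (real j * \<alpha> + 1))"

definition gradient :: "(real ^ 'n \<Rightarrow> real) \<Rightarrow> real ^ 'n \<Rightarrow> real ^ 'n" where
  "gradient f x = (\<chi> i. frechet_derivative f (at x) (axis i 1))"

definition hessian :: "(real ^ 'n \<Rightarrow> real) \<Rightarrow> real ^ 'n \<Rightarrow> real ^ 'n ^ 'n" where
  "hessian f x = jacobian (gradient f) (at x)"

definition class_C2 :: "(real ^ 'n \<Rightarrow> real) \<Rightarrow> bool" where
  "class_C2 f \<longleftrightarrow>
     f differentiable_on UNIV \<and> gradient f differentiable_on UNIV \<and> continuous_on UNIV (hessian f)"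

(* Used for symmetric matrices only; the Hessian of a C^2 function is symmetric. *)
definition matrix_le :: "real ^ 'n ^ 'n \<Rightarrow> real ^ 'n ^ 'n \<Rightarrow> bool" where
  "matrix_le A B \<longleftrightarrow> (\<forall>x. (A *v x) \<bullet> x \<le> (B *v x) \<bullet> x)"

(* Derivative of a function on the half-line from l: one-sided at l, two-sided at t > l. *)
definition half_line_deriv :: "real \<Rightarrow> (real \<Rightarrow> 'a::real_normed_vector) \<Rightarrow> real \<Rightarrow> 'a" where
  "half_line_deriv l x t = vector_derivative x (at t within {l..})"

definition J_psi :: "real \<Rightarrow> (real \<Rightarrow> real) \<Rightarrow> (real \<Rightarrow> 'a::real_normed_vector) \<Rightarrow> real \<Rightarrow> 'a" where
  "J_psi l \<psi> x t = (1 / half_line_deriv l \<psi> t) *\<^sub>R half_line_deriv l x t"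

definition RL_integrand ::
  "real \<Rightarrow> (real \<Rightarrow> real) \<Rightarrow> real \<Rightarrow> (real \<Rightarrow> 'a::real_normed_vector) \<Rightarrow> real \<Rightarrow> real \<Rightarrow> 'a" where
  "RL_integrand l \<psi> \<gamma> x t \<tau> = ((\<psi> t - \<psi> \<tau>) powr (\<gamma> - 1) * half_line_deriv l \<psi> \<tau>) *\<^sub>R x \<tau>"

(* The integral is the Henstock-Kurzweil integral, which extends both the Lebesgue and the
   improper Riemann integral; on a Euclidean space it is taken componentwise
   (integrable_componentwise_iff, integral_component_eq). *)
definition RL_integral ::
  "real \<Rightarrow> (real \<Rightarrow> real) \<Rightarrow> real \<Rightarrow> (real \<Rightarrow> 'a::euclidean_space) \<Rightarrow> real \<Rightarrow> 'a" where
  "RL_integral l \<psi> \<gamma> x t =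
     (if \<gamma> = 0 then x t
      else (1 / Gamma \<gamma>) *\<^sub>R integral {l..t} (RL_integrand l \<psi> \<gamma> x t))"

definition psi_Caputo ::
  "real \<Rightarrow> (real \<Rightarrow> real) \<Rightarrow> real \<Rightarrow> (real \<Rightarrow> 'a::euclidean_space) \<Rightarrow> real \<Rightarrow> 'a" where
  "psi_Caputo l \<psi> \<alpha> x = RL_integral l \<psi> (1 - \<alpha>) (J_psi l \<psi> x)"

(* The derivative and the integral in psi_Caputo really exist at t > l.  Differentiability at l
   itself is not required: solutions of fractional equations with \<alpha> < 1 usually behave like
   (t - l) powr \<alpha> near l. *)
definition psi_Caputo_exists ::
  "real \<Rightarrow> (real \<Rightarrow> real) \<Rightarrow> real \<Rightarrow> (real \<Rightarrow> 'a::euclidean_space) \<Rightarrow> real \<Rightarrow> bool" where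
  "psi_Caputo_exists l \<psi> \<alpha> x t \<longleftrightarrow>
     (\<forall>\<tau>\<in>{l<..t}. x differentiable (at \<tau> within {l..})) \<and>
     (\<alpha> = 1 \<or> RL_integrand l \<psi> (1 - \<alpha>) (J_psi l \<psi> x) t integrable_on {l..t})"

(* At t = l the value is the limit from the right: for \<alpha> < 1 the integral over the degenerate
   interval {l..l} is 0, and an equation read that way would force its right-hand side to
   vanish at l. *)
definition has_psi_Caputo ::
  "real \<Rightarrow> (real \<Rightarrow> real) \<Rightarrow> real \<Rightarrow> (real \<Rightarrow> 'a::euclidean_space) \<Rightarrow> 'a \<Rightarrow> real \<Rightarrow> bool" where
  "has_psi_Caputo l \<psi> \<alpha> x D t \<longleftrightarrow>
     (if t = l
      then (\<forall>\<^sub>F s in at_right l. psi_Caputo_exists l \<psi> \<alpha> x s) \<and>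
           (psi_Caputo l \<psi> \<alpha> x \<longlongrightarrow> D) (at_right l)
      else psi_Caputo_exists l \<psi> \<alpha> x t \<and> psi_Caputo l \<psi> \<alpha> x t = D)"

definition fractional_gradient_flow ::
  "real \<Rightarrow> (real \<Rightarrow> real) \<Rightarrow> real \<Rightarrow> real \<Rightarrow> (real ^ 'n \<Rightarrow> real) \<Rightarrow> real ^ 'n \<Rightarrow> (real \<Rightarrow> real ^ 'n) \<Rightarrow> bool"
where
  "fractional_gradient_flow l \<psi> \<alpha> \<beta> f z0 z \<longleftrightarrow>
     continuous_on {l..} z \<and>
     (\<forall>t\<ge>l. has_psi_Caputo l \<psi> \<alpha> z (- \<beta> *\<^sub>R gradient f (z t)) t) \<and>
     z l = z0"

end

theory Submission
  imports Defs
begin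

text \<open>The proof compares \<open>V t = (norm (z t - y))\<^sup>2\<close>, where \<open>y\<close> is the critical point of \<open>f\<close>, with
  the Mittag-Leffler function by a maximum principle.

  Strong convexity makes the gradient strongly monotone (\<open>strongly_monotone_gradient\<close>), so a
  solution satisfies \<open>2 * ((z t - y) \<bullet> D z t) \<le> - \<beta> * m_f * V t\<close>, with \<open>D\<close> the fractional
  derivative. For an ordinary derivative the left-hand side would be \<open>D V t\<close>; for a fractional
  one it is only an upper bound of it. The Mittag-Leffler function \<open>W\<close> of the claimed bound
  solves \<open>D W = - \<beta> * m_f * W\<close> with \<open>W l = V l\<close>.

  The tool for comparing them is that \<open>D h t \<ge> 0\<close> whenever \<open>h\<close> attains its maximum over
  \<open>{l..t}\<close> at \<open>t\<close> (\<open>has_psi_Caputo_nonneg_at_max\<close>), which follows from integration by parts.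
  Nothing is known about the derivative of \<open>z\<close> beyond its existence and the existence of a
  possibly conditionally convergent integral, so converting the equation into a Volterra
  integral equation would require an interchange of such integrals. The maximum principle
  avoids this, and it also avoids fractional derivatives of \<open>V\<close>: at the point \<open>s\<close> where
  \<open>V - W\<close> is maximal, it is applied to the linear functional \<open>2 * ((z s - y) \<bullet> z \<tau>)\<close> of the
  solution in place of \<open>V \<tau>\<close>.

  Finally, \<open>W\<close> is replaced by partial sums of its series, whose terms are differentiated by
  means of the Beta integral (\<open>has_psi_Caputo_power\<close>). A partial sum satisfies the equation
  for \<open>W\<close> with a multiple of its last term as the error, so the comparison holds up to that term
  (\<open>norm_decay_mittag_leffler_poly\<close>) and the bound follows in the limit. The estimate for the
  values of \<open>f\<close> is then the quadratic upper bound for a function with Lipschitz gradient at a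
  critical point (\<open>descent_lemma_at_critical_point\<close>).\<close>

section \<open>Mittag-Leffler series and their partial sums\<close>

lemma Gamma_plus1_pos:
  fixes x :: real
  assumes "0 < x"
  shows "Gamma (x + 1) = x * Gamma x"
  using assms nonpos_Ints_nonpos[of x] by (intro Gamma_plus1) fastforce

text \<open>Log-convexity of \<open>Gamma\<close>, applied to \<open>x + 1\<close> as a point between \<open>x + \<alpha>\<close> and \<open>x + \<alpha> + 1\<close>,
  gives \<open>x * Gamma x \<le> Gamma (x + \<alpha>) * (x + \<alpha>) powr (1 - \<alpha>)\<close>. The quotient is that of
  consecutive coefficients of the Mittag-Leffler series, which by this bound tends to zero.\<close>

lemma Gamma_shift_quotient_le:
  fixes x \<alpha> :: real
  assumes "1 \<le> x" "0 < \<alpha>" "\<alpha> \<le> 1"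
  shows "Gamma x / Gamma (x + \<alpha>) \<le> 2 * x powr (- \<alpha>)"
proof -
  have pos: "Gamma (x + \<alpha>) > 0" "Gamma x > 0" "Gamma (x + 1) > 0" "Gamma (x + \<alpha> + 1) > 0"
    using assms by auto
  note nz = pos[THEN less_imp_neq, THEN not_sym]
  have "(ln \<circ> Gamma) ((1 - (1 - \<alpha>)) *\<^sub>R (x + \<alpha>) + (1 - \<alpha>) *\<^sub>R (x + \<alpha> + 1))
      \<le> (1 - (1 - \<alpha>)) * (ln \<circ> Gamma) (x + \<alpha>) + (1 - \<alpha>) * (ln \<circ> Gamma) (x + \<alpha> + 1)"
    using assms by (intro convex_onD[OF log_convex_Gamma_real]) auto
  moreover have "(1 - (1 - \<alpha>)) *\<^sub>R (x + \<alpha>) + (1 - \<alpha>) *\<^sub>R (x + \<alpha> + 1) = x + 1"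
    by (simp add: algebra_simps)
  moreover have "ln (Gamma (x + \<alpha> + 1)) = ln (x + \<alpha>) + ln (Gamma (x + \<alpha>))"
    using ln_mult_pos[of "x + \<alpha>" "Gamma (x + \<alpha>)"] Gamma_plus1_pos[of "x + \<alpha>"] assms pos(1) by simp
  ultimately have "ln (Gamma (x + 1)) \<le> ln (Gamma (x + \<alpha>)) + (1 - \<alpha>) * ln (x + \<alpha>)"
    by (simp add: algebra_simps)
  also have "\<dots> = ln (Gamma (x + \<alpha>) * (x + \<alpha>) powr (1 - \<alpha>))"
    using assms pos by (simp add: ln_mult ln_powr nz)
  finally have "x * Gamma x \<le> Gamma (x + \<alpha>) * (x + \<alpha>) powr (1 - \<alpha>)"
    using assms pos by (simp add: Gamma_plus1_pos)
  then have "Gamma x / Gamma (x + \<alpha>) \<le> (x + \<alpha>) powr (1 - \<alpha>) / x"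
    using assms pos by (simp add: field_simps nz)
  also have "\<dots> \<le> (2 * x) powr (1 - \<alpha>) / x"
    using assms by (intro divide_right_mono powr_mono2) auto
  also have "\<dots> = 2 powr (1 - \<alpha>) * x powr (- \<alpha>)"
    using assms by (simp add: powr_mult powr_diff powr_minus divide_simps)
  also have "\<dots> \<le> 2 powr 1 * x powr (- \<alpha>)"
    using assms by (intro mult_right_mono powr_mono) auto
  finally show ?thesis by simp
qed

lemma summable_mittag_leffler:
  fixes w \<alpha> :: real
  assumes "0 < \<alpha>" "\<alpha> \<le> 1"
  shows "summable (\<lambda>j. w ^ j / Gamma (real j * \<alpha> + 1))"
proof -
  have "filterlim (\<lambda>j. real j * \<alpha>) at_top sequentially"
    using assms by (intro filterlim_at_top_mult_tendsto_pos[OF tendsto_const] filterlim_real_sequentially)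
  then have "filterlim (\<lambda>j. 1 + real j * \<alpha>) at_top sequentially"
    by (intro filterlim_tendsto_add_at_top[OF tendsto_const])
  then have "filterlim (\<lambda>j. real j * \<alpha> + 1) at_top sequentially"
    by (simp add: add.commute)
  then have "(\<lambda>j. (real j * \<alpha> + 1) powr (- \<alpha>)) \<longlonglongrightarrow> 0"
    using assms by (intro tendsto_neg_powr) auto
  then have "(\<lambda>j. \<bar>w\<bar> * (2 * (real j * \<alpha> + 1) powr (- \<alpha>))) \<longlonglongrightarrow> 0"
    using tendsto_mult_left[of "\<lambda>j. (real j * \<alpha> + 1) powr (- \<alpha>)" 0 sequentially "\<bar>w\<bar> * 2"]
    by (simp add: mult.assoc)
  then have "\<forall>\<^sub>F j in sequentially. \<bar>w\<bar> * (2 * (real j * \<alpha> + 1) powr (- \<alpha>)) < 1 / 2"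
    by (rule order_tendstoD) simp
  then obtain N where N: "\<And>j. j \<ge> N \<Longrightarrow> \<bar>w\<bar> * (2 * (real j * \<alpha> + 1) powr (- \<alpha>)) < 1 / 2"
    by (auto simp: eventually_sequentially)
  show ?thesis
  proof (rule summable_ratio_test[of "1/2" N])
    fix j assume j: "N \<le> j"
    let ?x = "real j * \<alpha> + 1"
    have x: "?x \<ge> 1" using assms by simp
    have Suc: "real (Suc j) * \<alpha> + 1 = ?x + \<alpha>" by (simp add: algebra_simps)
    have pos: "Gamma ?x > 0" "Gamma (?x + \<alpha>) > 0" using x assms by (intro Gamma_real_pos; linarith)+
    have "\<bar>w\<bar> * (Gamma ?x / Gamma (?x + \<alpha>)) \<le> \<bar>w\<bar> * (2 * ?x powr (- \<alpha>))"
      using Gamma_shift_quotient_le[OF x assms] by (intro mult_left_mono) auto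
    also note N[OF j]
    finally have le: "\<bar>w\<bar> * (Gamma ?x / Gamma (?x + \<alpha>)) \<le> 1 / 2"
      by (rule less_imp_le)
    have "norm (w ^ Suc j / Gamma (real (Suc j) * \<alpha> + 1))
        = (\<bar>w\<bar> * (Gamma ?x / Gamma (?x + \<alpha>))) * (\<bar>w\<bar> ^ j / Gamma ?x)"
      unfolding Suc using pos by (simp add: abs_mult power_abs)
    also have "\<dots> \<le> 1 / 2 * (\<bar>w\<bar> ^ j / Gamma ?x)"
      using le pos by (intro mult_right_mono) auto
    finally show "norm (w ^ Suc j / Gamma (real (Suc j) * \<alpha> + 1))
        \<le> 1 / 2 * norm (w ^ j / Gamma (real j * \<alpha> + 1))"
      using pos by (simp add: abs_mult power_abs)
  qed simp
qed

text \<open>The comparison below uses the partial sums and not their limit: they can be differentiated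
  term by term without interchanging a series with an integral.\<close>

definition mittag_leffler_poly :: "real \<Rightarrow> nat \<Rightarrow> real \<Rightarrow> real" where
  "mittag_leffler_poly \<alpha> n w = (\<Sum>j<n. w ^ j / Gamma (real j * \<alpha> + 1))"

lemma mittag_leffler_poly_tendsto:
  assumes "0 < \<alpha>" "\<alpha> \<le> 1"
  shows "(\<lambda>n. mittag_leffler_poly \<alpha> n w) \<longlonglongrightarrow> mittag_leffler \<alpha> w"
  unfolding mittag_leffler_poly_def mittag_leffler_def
  using summable_mittag_leffler[OF assms] by (rule summable_LIMSEQ)

lemma mittag_leffler_poly_Suc:
  "mittag_leffler_poly \<alpha> (Suc n) w = mittag_leffler_poly \<alpha> n w + w ^ n / Gamma (real n * \<alpha> + 1)"
  by (simp add: mittag_leffler_poly_def)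

lemma mittag_leffler_poly_zero: "mittag_leffler_poly \<alpha> (Suc n) 0 = 1"
  by (induction n) (auto simp: mittag_leffler_poly_def)

section \<open>Strongly convex functions and Lipschitz gradients\<close>

lemma gradient_inner:
  fixes f :: "real ^ 'n \<Rightarrow> real"
  assumes "f differentiable (at x)"
  shows "frechet_derivative f (at x) v = gradient f x \<bullet> v"
proof -
  interpret linear "frechet_derivative f (at x)"
    using assms linear_frechet_derivative by blast
  have "frechet_derivative f (at x) v = frechet_derivative f (at x) (\<Sum>i\<in>UNIV. v $ i *s axis i 1)"
    by (simp add: basis_expansion)
  also have "\<dots> = (\<Sum>i\<in>UNIV. v $ i * frechet_derivative f (at x) (axis i 1))"
    by (simp add: sum scale scalar_mult_eq_scaleR)
  also have "\<dots> = gradient f x \<bullet> v"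
    by (simp add: gradient_def inner_vec_def mult.commute)
  finally show ?thesis .
qed

text \<open>The mean value theorem on the segment from \<open>y\<close> to \<open>x\<close> reduces the claim to the lower bound
  for the Hessian as a quadratic form.\<close>

lemma strongly_monotone_gradient:
  fixes f :: "real ^ 'n \<Rightarrow> real"
  assumes diff: "gradient f differentiable_on UNIV"
    and le: "\<And>x. matrix_le (m *\<^sub>R mat 1) (hessian f x)"
  shows "m * (norm (x - y))\<^sup>2 \<le> (gradient f x - gradient f y) \<bullet> (x - y)"
proof -
  define v where "v = x - y"
  let ?\<phi> = "\<lambda>s. gradient f (y + s *\<^sub>R v) \<bullet> v"
  have der: "(?\<phi> has_real_derivative (hessian f (y + s *\<^sub>R v) *v v) \<bullet> v) (at s)" for s
  proof -
    have g: "(gradient f has_derivative (\<lambda>h. hessian f (y + s *\<^sub>R v) *v h)) (at (y + s *\<^sub>R v))"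
      using diff by (simp add: differentiable_on_def hessian_def flip: jacobian_works)
    have "((\<lambda>s. y + s *\<^sub>R v) has_derivative (\<lambda>h. h *\<^sub>R v)) (at s)"
      by (auto intro!: derivative_eq_intros)
    from has_derivative_compose[OF this g]
    have "((\<lambda>s. gradient f (y + s *\<^sub>R v)) has_derivative
        (\<lambda>h. hessian f (y + s *\<^sub>R v) *v (h *\<^sub>R v))) (at s)" .
    from has_derivative_inner_left[OF this, of v] show ?thesis
      by (simp add: has_field_derivative_def matrix_vector_mult_scaleR mult_commute_abs)
  qed
  obtain s where "?\<phi> 1 - ?\<phi> 0 = (1 - 0) * ((hessian f (y + s *\<^sub>R v) *v v) \<bullet> v)"
    using MVT2[of 0 1 ?\<phi> "\<lambda>s. (hessian f (y + s *\<^sub>R v) *v v) \<bullet> v"] der by auto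
  moreover have "m * (norm v)\<^sup>2 \<le> (hessian f (y + s *\<^sub>R v) *v v) \<bullet> v"
    using le[of "y + s *\<^sub>R v"]
    by (auto simp: matrix_le_def power2_norm_eq_inner dest: spec[of _ v]
        simp flip: scaleR_matrix_vector_assoc)
  ultimately show ?thesis by (simp add: v_def inner_diff_left)
qed

text \<open>Along the segment from \<open>y\<close> to \<open>x\<close> the slope of \<open>f\<close> at parameter \<open>s\<close> is at most \<open>L * s *
  (norm (x - y))\<^sup>2\<close>, because the gradient vanishes at \<open>y\<close>; integrating over \<open>s\<close> produces the
  factor one half.\<close>

lemma descent_lemma_at_critical_point:
  fixes f :: "real ^ 'n \<Rightarrow> real"
  assumes diff: "f differentiable_on UNIV" and crit: "gradient f y = 0"
    and lip: "\<And>x y. norm (gradient f x - gradient f y) \<le> L * norm (x - y)"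
  shows "f x - f y \<le> 1 / 2 * L * (norm (x - y))\<^sup>2"
proof -
  define v where "v = x - y"
  let ?\<phi> = "\<lambda>s. 1 / 2 * L * s\<^sup>2 * (norm v)\<^sup>2 - f (y + s *\<^sub>R v)"
  have der: "(?\<phi> has_real_derivative L * s * (norm v)\<^sup>2 - gradient f (y + s *\<^sub>R v) \<bullet> v) (at s)" for s
  proof -
    have d: "f differentiable (at (y + s *\<^sub>R v))"
      using diff by (simp add: differentiable_on_def)
    have g: "(f has_derivative (\<lambda>h. gradient f (y + s *\<^sub>R v) \<bullet> h)) (at (y + s *\<^sub>R v))"
      using d frechet_derivative_works[of f] by (simp add: gradient_inner[OF d, symmetric])
    have "((\<lambda>s. y + s *\<^sub>R v) has_derivative (\<lambda>h. h *\<^sub>R v)) (at s)"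
      by (auto intro!: derivative_eq_intros)
    from has_derivative_compose[OF this g]
    have "((\<lambda>s. f (y + s *\<^sub>R v)) has_real_derivative gradient f (y + s *\<^sub>R v) \<bullet> v) (at s)"
      by (simp add: has_field_derivative_def mult_commute_abs)
    then show ?thesis by (auto intro!: derivative_eq_intros)
  qed
  have "?\<phi> 0 \<le> ?\<phi> 1"
  proof (rule DERIV_nonneg_imp_nondecreasing[of 0 1 ?\<phi>])
    fix s :: real assume s: "0 \<le> s"
    have "gradient f (y + s *\<^sub>R v) \<bullet> v \<le> norm (gradient f (y + s *\<^sub>R v)) * norm v"
      by (rule norm_cauchy_schwarz)
    also have "\<dots> \<le> (L * norm (s *\<^sub>R v)) * norm v"
      using lip[of "y + s *\<^sub>R v" y] crit by (intro mult_right_mono) auto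
    finally have "0 \<le> L * s * (norm v)\<^sup>2 - gradient f (y + s *\<^sub>R v) \<bullet> v"
      using s by (simp add: power2_eq_square mult.assoc)
    then show "\<exists>d. (?\<phi> has_real_derivative d) (at s) \<and> 0 \<le> d"
      using der by blast
  qed simp
  then show ?thesis by (simp add: v_def)
qed

section \<open>Caputo derivatives with respect to a function\<close>

lemma at_within_half_line: "l < \<tau> \<Longrightarrow> at \<tau> within {l..} = at (\<tau>::real)"
  by (rule at_within_interior) (simp add: interior_real_atLeast)

lemma differentiable_half_line_iff:
  fixes x :: "real \<Rightarrow> 'a::real_normed_vector"
  assumes "l < \<tau>"
  shows "x differentiable (at \<tau> within {l..}) \<longleftrightarrow> x differentiable (at \<tau>)"
  using assms by (simp add: at_within_half_line)

lemma half_line_deriv_eqI: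
  fixes x :: "real \<Rightarrow> 'a::real_normed_vector"
  assumes "l < \<tau>" "(x has_vector_derivative d) (at \<tau>)"
  shows "half_line_deriv l x \<tau> = d"
  using assms by (simp add: half_line_deriv_def at_within_half_line vector_derivative_at)

locale time_scale =
  fixes l :: real and \<psi> :: "real \<Rightarrow> real"
  assumes strict_mono_scale: "strict_mono_on {l..} \<psi>"
    and differentiable_scale: "\<psi> differentiable_on {l..}"
    and scale_deriv_pos: "\<And>t. l \<le> t \<Longrightarrow> 0 < half_line_deriv l \<psi> t"
begin

abbreviation scale_deriv :: "real \<Rightarrow> real" where
  "scale_deriv \<equiv> half_line_deriv l \<psi>"

lemma scale_less: "l \<le> a \<Longrightarrow> a < b \<Longrightarrow> \<psi> a < \<psi> b"
  using strict_mono_scale by (auto simp: strict_mono_on_def)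

lemma scale_le: "l \<le> a \<Longrightarrow> a \<le> b \<Longrightarrow> \<psi> a \<le> \<psi> b"
  using scale_less[of a b] by (cases "a = b") auto

lemma scale_derivative_within:
  assumes "l \<le> t"
  shows "(\<psi> has_real_derivative scale_deriv t) (at t within {l..})"
  using differentiable_scale assms
  by (simp add: differentiable_on_def vector_derivative_works half_line_deriv_def
      has_real_derivative_iff_has_vector_derivative)

lemma scale_derivative:
  assumes "l < t"
  shows "(\<psi> has_real_derivative scale_deriv t) (at t)"
  using scale_derivative_within[of t] assms by (simp add: at_within_half_line)

lemma continuous_on_scale: "continuous_on {l..} \<psi>"
  using differentiable_scale differentiable_imp_continuous_on by blast

lemma RL_integrand_J_psi:
  fixes x :: "real \<Rightarrow> 'a::real_normed_vector"
  assumes "l < \<tau>" "(x has_vector_derivative d) (at \<tau>)"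
  shows "RL_integrand l \<psi> (1 - \<alpha>) (J_psi l \<psi> x) t \<tau> = (\<psi> t - \<psi> \<tau>) powr (- \<alpha>) *\<^sub>R d"
  using scale_deriv_pos[of \<tau>] assms
  by (simp add: RL_integrand_def J_psi_def half_line_deriv_eqI[OF assms])

text \<open>For \<open>l < t\<close> the factor \<open>\<psi>'\<close> of the kernel cancels the \<open>1 / \<psi>'\<close> of \<open>J_psi\<close>, so that only the
  ordinary derivative of \<open>x\<close> is left. It is bound by an existential quantifier because this
  makes linearity immediate in both cases, \<open>\<alpha> = 1\<close> and \<open>\<alpha> < 1\<close>.\<close>

lemma has_psi_Caputo_iff:
  fixes x :: "real \<Rightarrow> 'a::euclidean_space"
  assumes "l < t" "\<alpha> \<le> 1"
  shows "has_psi_Caputo l \<psi> \<alpha> x D t \<longleftrightarrow>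
    (\<exists>x'. (\<forall>\<tau>\<in>{l<..t}. (x has_vector_derivative x' \<tau>) (at \<tau>)) \<and>
      (if \<alpha> = 1 then x' t = scale_deriv t *\<^sub>R D
       else ((\<lambda>\<tau>. (\<psi> t - \<psi> \<tau>) powr (- \<alpha>) *\<^sub>R x' \<tau>) has_integral Gamma (1 - \<alpha>) *\<^sub>R D) {l..t}))"
    (is "?L \<longleftrightarrow> (\<exists>x'. ?D x' \<and> ?R x')")
proof -
  have pos: "scale_deriv t > 0" using scale_deriv_pos assms by simp
  have G: "Gamma (1 - \<alpha>) > 0" if "\<alpha> \<noteq> 1"
    using assms that by (intro Gamma_real_pos) auto
  have key: "(psi_Caputo l \<psi> \<alpha> x t = D \<and>
      (\<alpha> = 1 \<or> RL_integrand l \<psi> (1 - \<alpha>) (J_psi l \<psi> x) t integrable_on {l..t})) \<longleftrightarrow> ?R x'"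
    if D: "?D x'" for x'
  proof (cases "\<alpha> = 1")
    case True
    have "half_line_deriv l x t = x' t"
      using D assms by (intro half_line_deriv_eqI) auto
    then have "psi_Caputo l \<psi> \<alpha> x t = (1 / scale_deriv t) *\<^sub>R x' t"
      using True by (simp add: psi_Caputo_def RL_integral_def J_psi_def)
    then show ?thesis using True pos by (auto simp: field_simps)
  next
    case False
    let ?K = "RL_integrand l \<psi> (1 - \<alpha>) (J_psi l \<psi> x) t"
    let ?k = "\<lambda>\<tau>. (\<psi> t - \<psi> \<tau>) powr (- \<alpha>) *\<^sub>R x' \<tau>"
    \<comment> \<open>The one-sided derivative at \<open>l\<close> may fail to exist, but a single point does not affect the integral.\<close>
    have eq: "?K \<tau> = ?k \<tau>" if "\<tau> \<in> {l..t} - {l}" for \<tau>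
      using D that by (intro RL_integrand_J_psi) auto
    have iff: "(?K has_integral I) {l..t} \<longleftrightarrow> (?k has_integral I) {l..t}" for I
      using has_integral_spike_finite[of "{l}" "{l..t}" ?K ?k I]
        has_integral_spike_finite[of "{l}" "{l..t}" ?k ?K I] eq by auto
    have "(psi_Caputo l \<psi> \<alpha> x t = D \<and> ?K integrable_on {l..t}) \<longleftrightarrow>
        (integral {l..t} ?K = Gamma (1 - \<alpha>) *\<^sub>R D \<and> ?K integrable_on {l..t})"
      using False G by (auto simp: psi_Caputo_def RL_integral_def)
    also have "\<dots> \<longleftrightarrow> (?K has_integral Gamma (1 - \<alpha>) *\<^sub>R D) {l..t}"
      by (metis has_integral_integrable_integral)
    finally show ?thesis using False iff by simp
  qed
  show ?thesis
  proof
    assume L: ?L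
    define x' where "x' = (\<lambda>\<tau>. vector_derivative x (at \<tau>))"
    have D: "?D x'"
    proof
      fix \<tau> assume \<tau>: "\<tau> \<in> {l<..t}"
      then have "x differentiable (at \<tau>)"
        using L assms by (auto simp: has_psi_Caputo_def psi_Caputo_exists_def differentiable_half_line_iff)
      then show "(x has_vector_derivative x' \<tau>) (at \<tau>)"
        by (simp add: x'_def vector_derivative_works)
    qed
    have "?R x'"
      using L assms key[OF D] by (auto simp: has_psi_Caputo_def psi_Caputo_exists_def)
    with D show "\<exists>x'. ?D x' \<and> ?R x'" by blast
  next
    assume "\<exists>x'. ?D x' \<and> ?R x'"
    then obtain x' where x': "?D x'" "?R x'" by blast
    have "\<forall>\<tau>\<in>{l<..t}. x differentiable (at \<tau> within {l..})"
      using x'(1) by (auto simp: differentiable_half_line_iff intro: differentiableI_vector)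
    then show ?L
      using assms key[OF x'(1)] x'(2) by (auto simp: has_psi_Caputo_def psi_Caputo_exists_def)
  qed
qed

lemma has_psi_Caputo_linear:
  fixes x :: "real \<Rightarrow> 'a::euclidean_space" and A :: "'a \<Rightarrow> 'b::euclidean_space"
  assumes "l < t" "\<alpha> \<le> 1" and A: "bounded_linear A" and x: "has_psi_Caputo l \<psi> \<alpha> x D t"
  shows "has_psi_Caputo l \<psi> \<alpha> (\<lambda>\<tau>. A (x \<tau>)) (A D) t"
proof -
  interpret A: bounded_linear A by fact
  obtain x' where D: "\<And>\<tau>. \<tau> \<in> {l<..t} \<Longrightarrow> (x has_vector_derivative x' \<tau>) (at \<tau>)"
    and R: "if \<alpha> = 1 then x' t = scale_deriv t *\<^sub>R D
       else ((\<lambda>\<tau>. (\<psi> t - \<psi> \<tau>) powr (- \<alpha>) *\<^sub>R x' \<tau>) has_integral Gamma (1 - \<alpha>) *\<^sub>R D) {l..t}"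
    using iffD1[OF has_psi_Caputo_iff[OF assms(1,2)] x] by blast
  have "\<forall>\<tau>\<in>{l<..t}. ((\<lambda>\<tau>. A (x \<tau>)) has_vector_derivative A (x' \<tau>)) (at \<tau>)"
    using D A.has_vector_derivative by blast
  moreover have "if \<alpha> = 1 then A (x' t) = scale_deriv t *\<^sub>R A D
      else ((\<lambda>\<tau>. (\<psi> t - \<psi> \<tau>) powr (- \<alpha>) *\<^sub>R A (x' \<tau>)) has_integral Gamma (1 - \<alpha>) *\<^sub>R A D) {l..t}"
    using R by (auto simp: A.scaleR o_def dest!: has_integral_linear[OF _ A])
  ultimately show ?thesis
    unfolding has_psi_Caputo_iff[OF assms(1,2)] by (intro exI[of _ "\<lambda>\<tau>. A (x' \<tau>)"]) auto
qed

lemma has_psi_Caputo_add: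
  fixes x y :: "real \<Rightarrow> 'a::euclidean_space"
  assumes "l < t" "\<alpha> \<le> 1"
    and x: "has_psi_Caputo l \<psi> \<alpha> x D t" and y: "has_psi_Caputo l \<psi> \<alpha> y E t"
  shows "has_psi_Caputo l \<psi> \<alpha> (\<lambda>\<tau>. x \<tau> + y \<tau>) (D + E) t"
proof -
  obtain x' where x': "\<And>\<tau>. \<tau> \<in> {l<..t} \<Longrightarrow> (x has_vector_derivative x' \<tau>) (at \<tau>)"
    "if \<alpha> = 1 then x' t = scale_deriv t *\<^sub>R D
       else ((\<lambda>\<tau>. (\<psi> t - \<psi> \<tau>) powr (- \<alpha>) *\<^sub>R x' \<tau>) has_integral Gamma (1 - \<alpha>) *\<^sub>R D) {l..t}"
    using iffD1[OF has_psi_Caputo_iff[OF assms(1,2)] x] by blast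
  obtain y' where y': "\<And>\<tau>. \<tau> \<in> {l<..t} \<Longrightarrow> (y has_vector_derivative y' \<tau>) (at \<tau>)"
    "if \<alpha> = 1 then y' t = scale_deriv t *\<^sub>R E
       else ((\<lambda>\<tau>. (\<psi> t - \<psi> \<tau>) powr (- \<alpha>) *\<^sub>R y' \<tau>) has_integral Gamma (1 - \<alpha>) *\<^sub>R E) {l..t}"
    using iffD1[OF has_psi_Caputo_iff[OF assms(1,2)] y] by blast
  have "\<forall>\<tau>\<in>{l<..t}. ((\<lambda>\<tau>. x \<tau> + y \<tau>) has_vector_derivative x' \<tau> + y' \<tau>) (at \<tau>)"
    using x'(1) y'(1) has_vector_derivative_add by blast
  moreover have "if \<alpha> = 1 then x' t + y' t = scale_deriv t *\<^sub>R (D + E)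
      else ((\<lambda>\<tau>. (\<psi> t - \<psi> \<tau>) powr (- \<alpha>) *\<^sub>R (x' \<tau> + y' \<tau>)) has_integral
        Gamma (1 - \<alpha>) *\<^sub>R (D + E)) {l..t}"
    using x'(2) y'(2) by (auto simp: scaleR_add_right intro: has_integral_add)
  ultimately show ?thesis
    unfolding has_psi_Caputo_iff[OF assms(1,2)] by (intro exI[of _ "\<lambda>\<tau>. x' \<tau> + y' \<tau>"]) auto
qed

lemma has_psi_Caputo_const:
  fixes c :: "'a::euclidean_space"
  assumes "l < t" "\<alpha> \<le> 1"
  shows "has_psi_Caputo l \<psi> \<alpha> (\<lambda>\<tau>. c) 0 t"
  unfolding has_psi_Caputo_iff[OF assms] by (intro exI[of _ "\<lambda>\<tau>. 0"]) auto

section \<open>The maximum principle\<close>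

lemma kernel_derivative:
  assumes "l < \<tau>" "\<tau> < t"
  shows "((\<lambda>\<tau>. (\<psi> t - \<psi> \<tau>) powr (- \<alpha>)) has_real_derivative
           \<alpha> * (\<psi> t - \<psi> \<tau>) powr (- \<alpha> - 1) * scale_deriv \<tau>) (at \<tau>)"
  using scale_less[of \<tau> t] assms
  by (auto intro!: derivative_eq_intros scale_derivative)

text \<open>The boundary term at \<open>t\<close> in the integration by parts below. The quotient of \<open>h \<tau> - h t\<close> by
  \<open>\<psi> \<tau> - \<psi> t\<close> converges, because \<open>h\<close> and \<open>\<psi>\<close> are differentiable at \<open>t\<close> and \<open>\<psi>' t > 0\<close>; the
  remaining factor \<open>(\<psi> t - \<psi> \<tau>) powr (1 - \<alpha>)\<close> tends to zero.\<close>

lemma kernel_boundary_term_tendsto_zero: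
  fixes h :: "real \<Rightarrow> real"
  assumes "l < t" "\<alpha> < 1" and h: "(h has_real_derivative d) (at t)"
  shows "((\<lambda>\<tau>. (\<psi> t - \<psi> \<tau>) powr (- \<alpha>) * (h \<tau> - h t)) \<longlongrightarrow> 0) (at_left t)"
proof -
  have "((\<lambda>\<tau>. (h \<tau> - h t) / (\<tau> - t)) \<longlongrightarrow> d) (at_left t)"
    using h by (auto simp: has_field_derivative_iff intro: filterlim_mono at_le)
  moreover have "((\<lambda>\<tau>. (\<psi> \<tau> - \<psi> t) / (\<tau> - t)) \<longlongrightarrow> scale_deriv t) (at_left t)"
    using scale_derivative[OF \<open>l < t\<close>] by (auto simp: has_field_derivative_iff intro: filterlim_mono at_le)
  ultimately have "((\<lambda>\<tau>. ((h \<tau> - h t) / (\<tau> - t)) / ((\<psi> \<tau> - \<psi> t) / (\<tau> - t)))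
      \<longlongrightarrow> d / scale_deriv t) (at_left t)"
    using scale_deriv_pos[of t] assms by (intro tendsto_divide) auto
  note quotient = this
  have power: "((\<lambda>\<tau>. (\<psi> t - \<psi> \<tau>) powr (1 - \<alpha>)) \<longlongrightarrow> 0 powr (1 - \<alpha>)) (at_left t)"
  proof (rule tendsto_powr')
    have "isCont \<psi> t" using scale_derivative[OF \<open>l < t\<close>] DERIV_isCont by blast
    then have "(\<psi> \<longlongrightarrow> \<psi> t) (at_left t)"
      by (meson at_le filterlim_mono isCont_def order_refl subset_UNIV)
    then show "((\<lambda>\<tau>. \<psi> t - \<psi> \<tau>) \<longlongrightarrow> 0) (at_left t)"
      by (auto intro!: tendsto_eq_intros)
    have "\<forall>\<^sub>F \<tau> in at_left t. \<tau> \<in> {l<..<t}"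
      using assms by (intro eventually_at_left_real)
    then show "0 \<noteq> (0::real) \<or> 0 < 1 - \<alpha> \<and> (\<forall>\<^sub>F \<tau> in at_left t. 0 \<le> \<psi> t - \<psi> \<tau>)"
      using assms by (auto elim!: eventually_mono dest: scale_less[rotated])
  qed (auto intro!: tendsto_intros)
  have lim: "((\<lambda>\<tau>. - ((\<psi> t - \<psi> \<tau>) powr (1 - \<alpha>) *
      (((h \<tau> - h t) / (\<tau> - t)) / ((\<psi> \<tau> - \<psi> t) / (\<tau> - t))))) \<longlongrightarrow> 0) (at_left t)"
    using tendsto_minus[OF tendsto_mult[OF power quotient]] by simp
  have "\<forall>\<^sub>F \<tau> in at_left t. \<tau> \<in> {l<..<t}"
    using assms by (intro eventually_at_left_real)
  then have "\<forall>\<^sub>F \<tau> in at_left t. - ((\<psi> t - \<psi> \<tau>) powr (1 - \<alpha>) *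
      (((h \<tau> - h t) / (\<tau> - t)) / ((\<psi> \<tau> - \<psi> t) / (\<tau> - t)))) =
      (\<psi> t - \<psi> \<tau>) powr (- \<alpha>) * (h \<tau> - h t)"
  proof eventually_elim
    case (elim \<tau>)
    then have "\<psi> \<tau> < \<psi> t" using scale_less by auto
    moreover have "(\<psi> t - \<psi> \<tau>) powr (1 - \<alpha>) = (\<psi> t - \<psi> \<tau>) * (\<psi> t - \<psi> \<tau>) powr (- \<alpha>)"
      using powr_mult_base[of "\<psi> t - \<psi> \<tau>" "- \<alpha>"] calculation by simp
    ultimately show ?case using elim by (simp add: divide_simps) (simp add: algebra_simps)
  qed
  with lim show ?thesis by (rule Lim_transform_eventually)
qed

text \<open>Integrate by parts on \<open>{l..x}\<close> with \<open>x < t\<close>, using the primitive \<open>h - h t\<close> of \<open>h'\<close>. This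
  primitive is nonpositive, while the kernel \<open>k\<close> is positive and increasing, so both the
  integral of \<open>k' * (h - h t)\<close> and the boundary term at \<open>l\<close> have the favourable sign; the
  boundary term at \<open>x\<close> vanishes as \<open>x\<close> tends to \<open>t\<close>. Everything stays within the
  Henstock-Kurzweil integral: \<open>k * h'\<close> may be conditionally integrable, and its integral
  depends continuously on the upper limit all the same.\<close>

lemma kernel_integral_nonneg_at_max:
  fixes h :: "real \<Rightarrow> real"
  assumes "l < t" "0 < \<alpha>" "\<alpha> < 1" and cont: "continuous_on {l..t} h"
    and h': "\<And>\<tau>. \<tau> \<in> {l<..t} \<Longrightarrow> (h has_real_derivative h' \<tau>) (at \<tau>)"
    and I: "((\<lambda>\<tau>. (\<psi> t - \<psi> \<tau>) powr (- \<alpha>) * h' \<tau>) has_integral I) {l..t}"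
    and max: "\<And>\<tau>. \<tau> \<in> {l..t} \<Longrightarrow> h \<tau> \<le> h t"
  shows "0 \<le> I"
proof -
  define k where "k = (\<lambda>\<tau>. (\<psi> t - \<psi> \<tau>) powr (- \<alpha>))"
  define k' where "k' = (\<lambda>\<tau>. \<alpha> * (\<psi> t - \<psi> \<tau>) powr (- \<alpha> - 1) * scale_deriv \<tau>)"
  let ?b = "\<lambda>x. k x * (h x - h t)"
  let ?F = "\<lambda>x. integral {l..x} (\<lambda>\<tau>. k \<tau> * h' \<tau>)"
  have int: "(\<lambda>\<tau>. k \<tau> * h' \<tau>) integrable_on {l..t}"
    using I by (auto simp: k_def)
  have lower: "?b x \<le> ?F x" if x: "x \<in> {l<..<t}" for x
  proof -
    have less: "\<psi> \<tau> < \<psi> t" if "\<tau> \<in> {l..x}" for \<tau> using that x scale_less by auto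
    have "((\<lambda>\<tau>. k' \<tau> * (h \<tau> - h t) + k \<tau> * h' \<tau>) has_integral (?b x - ?b l)) {l..x}"
    proof (rule fundamental_theorem_of_calculus_interior)
      have "continuous_on {l..x} \<psi>" "continuous_on {l..x} h"
        using x continuous_on_scale cont by (auto elim: continuous_on_subset)
      then show "continuous_on {l..x} ?b"
        unfolding k_def using less by (intro continuous_intros) fastforce+
      show "(?b has_vector_derivative k' \<tau> * (h \<tau> - h t) + k \<tau> * h' \<tau>) (at \<tau>)"
        if \<tau>: "\<tau> \<in> {l<..<x}" for \<tau>
      proof -
        have "(k has_real_derivative k' \<tau>) (at \<tau>)"
          using kernel_derivative[of \<tau> t \<alpha>] x \<tau> by (simp add: k_def k'_def)
        moreover have "(h has_real_derivative h' \<tau>) (at \<tau>)" using h' x \<tau> by auto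
        ultimately show ?thesis
          unfolding has_real_derivative_iff_has_vector_derivative[symmetric]
          by (auto intro!: derivative_eq_intros)
      qed
    qed (use x in auto)
    moreover have "((\<lambda>\<tau>. k \<tau> * h' \<tau>) has_integral ?F x) {l..x}"
      using x by (intro integrable_integral integrable_on_subinterval[OF int]) auto
    ultimately have "((\<lambda>\<tau>. k \<tau> * h' \<tau> - (k' \<tau> * (h \<tau> - h t) + k \<tau> * h' \<tau>))
        has_integral (?F x - (?b x - ?b l))) {l..x}"
      by (intro has_integral_diff)
    then have "0 \<le> ?F x - (?b x - ?b l)"
    proof (rule has_integral_nonneg)
      fix \<tau> assume \<tau>: "\<tau> \<in> {l..x}"
      have "0 \<le> k' \<tau>" using \<tau> scale_deriv_pos[of \<tau>] \<open>0 < \<alpha>\<close> by (simp add: k'_def)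
      moreover have "h \<tau> - h t \<le> 0" using max[of \<tau>] \<tau> x by auto
      ultimately show "0 \<le> k \<tau> * h' \<tau> - (k' \<tau> * (h \<tau> - h t) + k \<tau> * h' \<tau>)"
        by (simp add: mult_nonneg_nonpos)
    qed
    moreover have "?b l \<le> 0"
      using max[of l] \<open>l < t\<close> by (auto simp: k_def intro!: mult_nonneg_nonpos)
    ultimately show ?thesis by simp
  qed
  have "(?b \<longlongrightarrow> 0) (at_left t)"
    unfolding k_def using assms by (intro kernel_boundary_term_tendsto_zero h') auto
  moreover have "(?F \<longlongrightarrow> ?F t) (at_left t)"
  proof -
    have "(?F \<longlongrightarrow> ?F t) (at t within {l..t})"
      using indefinite_integral_continuous_1[OF int] \<open>l < t\<close> by (auto simp: continuous_on_def)
    then show ?thesis using \<open>l < t\<close> by (simp add: at_within_Icc_at_left)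
  qed
  moreover have "\<forall>\<^sub>F x in at_left t. ?b x \<le> ?F x"
    using eventually_at_left_real[OF \<open>l < t\<close>] by eventually_elim (rule lower)
  ultimately have "0 \<le> ?F t" by (intro tendsto_le[of "at_left t" ?F "?F t" ?b 0]) auto
  moreover have "?F t = I" using integral_unique[OF I] by (simp add: k_def)
  ultimately show ?thesis by simp
qed

text \<open>The maximum principle. For \<open>\<alpha> = 1\<close> it says that the left-hand derivative at a maximum is
  nonnegative; for \<open>\<alpha> < 1\<close> the derivative depends on the whole past, which is why \<open>t\<close> has to
  maximize \<open>h\<close> over all of \<open>{l..t}\<close>.\<close>

lemma has_psi_Caputo_nonneg_at_max:
  fixes h :: "real \<Rightarrow> real"
  assumes "l < t" "0 < \<alpha>" "\<alpha> \<le> 1" and cont: "continuous_on {l..t} h"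
    and D: "has_psi_Caputo l \<psi> \<alpha> h D t"
    and max: "\<And>\<tau>. \<tau> \<in> {l..t} \<Longrightarrow> h \<tau> \<le> h t"
  shows "0 \<le> D"
proof -
  obtain h' where h': "\<And>\<tau>. \<tau> \<in> {l<..t} \<Longrightarrow> (h has_real_derivative h' \<tau>) (at \<tau>)"
    and R: "if \<alpha> = 1 then h' t = scale_deriv t * D
       else ((\<lambda>\<tau>. (\<psi> t - \<psi> \<tau>) powr (- \<alpha>) * h' \<tau>) has_integral Gamma (1 - \<alpha>) * D) {l..t}"
    using iffD1[OF has_psi_Caputo_iff[OF assms(1,3)] D]
    unfolding has_real_derivative_iff_has_vector_derivative real_scaleR_def by blast
  show ?thesis
  proof (cases "\<alpha> = 1")
    case True
    have "((\<lambda>\<tau>. (h \<tau> - h t) / (\<tau> - t)) \<longlongrightarrow> h' t) (at_left t)"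
      using h'[of t] \<open>l < t\<close> by (auto simp: has_field_derivative_iff intro: filterlim_mono at_le)
    moreover have "\<forall>\<^sub>F \<tau> in at_left t. 0 \<le> (h \<tau> - h t) / (\<tau> - t)"
      using eventually_at_left_real[OF \<open>l < t\<close>]
      by eventually_elim (use max in \<open>auto intro: divide_nonpos_neg\<close>)
    ultimately have "0 \<le> h' t"
      by (intro tendsto_lowerbound) auto
    then show ?thesis using True R scale_deriv_pos[of t] \<open>l < t\<close> by (simp add: zero_le_mult_iff)
  next
    case False
    then have "0 \<le> Gamma (1 - \<alpha>) * D"
      using assms R h' by (intro kernel_integral_nonneg_at_max[of t \<alpha> h h']) auto
    moreover have "0 < Gamma (1 - \<alpha>)" using False assms by (intro Gamma_real_pos) auto
    ultimately show ?thesis by (simp add: zero_le_mult_iff)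
  qed
qed

section \<open>Caputo derivatives of Mittag-Leffler partial sums\<close>

text \<open>With \<open>a = (j + 1) * \<alpha>\<close> and \<open>s = \<psi> t - \<psi> l\<close>, the substitution \<open>u = (\<psi> \<tau> - \<psi> l) / s\<close> turns the
  defining integral for \<open>\<alpha> < 1\<close> into a multiple of the Beta integral with parameters \<open>a\<close> and
  \<open>1 - \<alpha>\<close>. The function is written as a power of \<open>(\<psi> \<tau> - \<psi> l) powr \<alpha>\<close>, and not with exponent
  \<open>j * \<alpha>\<close>, because the term with exponent 0 in the partial sums must be the constant 1 also at
  \<open>l\<close>, whereas \<open>0 powr 0 = 0\<close>.\<close>

lemma has_psi_Caputo_power:
  assumes "l < t" "0 < \<alpha>" "\<alpha> \<le> 1"
  shows "has_psi_Caputo l \<psi> \<alpha> (\<lambda>\<tau>. ((\<psi> \<tau> - \<psi> l) powr \<alpha>) ^ Suc j)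
    (Gamma (real (Suc j) * \<alpha> + 1) / Gamma (real j * \<alpha> + 1) * ((\<psi> t - \<psi> l) powr \<alpha>) ^ j) t"
proof -
  define a where "a = real (Suc j) * \<alpha>"
  define s where "s = \<psi> t - \<psi> l"
  define x' where "x' = (\<lambda>\<tau>. a * (\<psi> \<tau> - \<psi> l) powr (a - 1) * scale_deriv \<tau>)"
  have a: "a > 0" using assms by (simp add: a_def)
  have s: "s > 0" using scale_less[of l t] assms by (simp add: s_def)
  have power: "(r powr \<alpha>) ^ k = r powr (real k * \<alpha>)" if "r > 0" for r :: real and k
    using that by (simp add: powr_power mult.commute)
  have nz: "Gamma (real j * \<alpha> + 1) > 0" using assms by (intro Gamma_real_pos) (simp add: add_nonneg_pos)
  have Ga: "Gamma (a + 1) = a * Gamma a" using a by (rule Gamma_plus1_pos)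
  have D: "((\<lambda>\<tau>. ((\<psi> \<tau> - \<psi> l) powr \<alpha>) ^ Suc j) has_vector_derivative x' \<tau>) (at \<tau>)"
    if \<tau>: "\<tau> \<in> {l<..t}" for \<tau>
  proof -
    have pos: "\<psi> \<tau> - \<psi> l > 0" using scale_less[of l \<tau>] \<tau> by auto
    have "((\<lambda>\<tau>. (\<psi> \<tau> - \<psi> l) powr a) has_real_derivative x' \<tau>) (at \<tau>)"
      unfolding x'_def using pos \<tau> by (auto intro!: derivative_eq_intros scale_derivative)
    moreover have "\<forall>\<^sub>F \<tau> in nhds \<tau>. (\<psi> \<tau> - \<psi> l) powr a = ((\<psi> \<tau> - \<psi> l) powr \<alpha>) ^ Suc j"
    proof -
      have "\<forall>\<^sub>F \<tau> in nhds \<tau>. \<tau> > l" using \<tau> by (intro eventually_nhds_in_open[of "{l<..}", simplified]) auto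
      then show ?thesis
        by eventually_elim (use scale_less[of l] in \<open>simp add: power a_def del: power_Suc of_nat_Suc\<close>)
    qed
    ultimately show ?thesis
      unfolding has_real_derivative_iff_has_vector_derivative[symmetric]
      by (subst DERIV_cong_ev[OF refl _ refl, symmetric])
  qed
  have "if \<alpha> = 1 then x' t = scale_deriv t *\<^sub>R (Gamma (a + 1) / Gamma (real j * \<alpha> + 1) * (s powr \<alpha>) ^ j)
    else ((\<lambda>\<tau>. (\<psi> t - \<psi> \<tau>) powr (- \<alpha>) *\<^sub>R x' \<tau>) has_integral
       Gamma (1 - \<alpha>) *\<^sub>R (Gamma (a + 1) / Gamma (real j * \<alpha> + 1) * (s powr \<alpha>) ^ j)) {l..t}"
  proof (cases "\<alpha> = 1")
    case True
    have "a = real j * \<alpha> + 1" using True by (simp add: a_def)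
    moreover have "s powr (real j) = s ^ j" using s by (simp add: powr_realpow)
    ultimately show ?thesis
      using True nz[THEN less_imp_neq, THEN not_sym] s Ga by (simp add: x'_def s_def[symmetric])
  next
    case False
    then have \<alpha>: "\<alpha> < 1" using assms by simp
    define f where "f = (\<lambda>u::real. u powr (a - 1) * (1 - u) powr (- \<alpha>))"
    define g where "g = (\<lambda>\<tau>. (\<psi> \<tau> - \<psi> l) / s)"
    have beta: "(f has_integral Beta a (1 - \<alpha>)) {0..1}"
      using has_integral_Beta_real[of a "1 - \<alpha>"] a \<alpha> by (simp add: f_def)
    have image: "g ` {l..t} = {0..1}"
    proof
      show "g ` {l..t} \<subseteq> {0..1}"
      proof
        fix u assume "u \<in> g ` {l..t}"
        then obtain \<tau> where "\<tau> \<in> {l..t}" "u = g \<tau>" by auto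
        then show "u \<in> {0..1}"
          using scale_le[of l \<tau>] scale_le[of \<tau> t] s by (simp add: g_def s_def)
      qed
      have "continuous_on {l..t} g"
        unfolding g_def using s continuous_on_subset[OF continuous_on_scale, of "{l..t}"]
        by (intro continuous_intros) auto
      moreover have "g l = 0" "g t = 1" using s by (auto simp: g_def s_def)
      ultimately show "{0..1} \<subseteq> g ` {l..t}"
        using IVT'[of g l _ t] assms by (force simp: image_iff)
    qed
    have "(\<lambda>\<tau>. \<bar>scale_deriv \<tau> / s\<bar> * f (g \<tau>)) absolutely_integrable_on {l..t} \<and>
        integral {l..t} (\<lambda>\<tau>. \<bar>scale_deriv \<tau> / s\<bar> * f (g \<tau>)) = Beta a (1 - \<alpha>) \<longleftrightarrow>
        f absolutely_integrable_on (g ` {l..t}) \<and> integral (g ` {l..t}) f = Beta a (1 - \<alpha>)"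
    proof (rule has_absolute_integral_change_of_variables_1')
      show "(g has_real_derivative scale_deriv \<tau> / s) (at \<tau> within {l..t})" if "\<tau> \<in> {l..t}" for \<tau>
        unfolding g_def using that s
        by (auto intro!: derivative_eq_intros has_field_derivative_subset[OF scale_derivative_within])
      show "inj_on g {l..t}"
      proof (rule linorder_inj_onI)
        show "g x \<noteq> g y" if "x < y" "x \<in> {l..t}" for x y
          using scale_less[of x y] that s by (auto simp: g_def)
      qed auto
    qed auto
    moreover have "f absolutely_integrable_on {0..1}"
      using beta by (intro nonnegative_absolutely_integrable_1) (auto simp: f_def)
    moreover have "integral {0..1} f = Beta a (1 - \<alpha>)" using beta by (rule integral_unique)
    ultimately have int: "((\<lambda>\<tau>. \<bar>scale_deriv \<tau> / s\<bar> * f (g \<tau>)) has_integral Beta a (1 - \<alpha>)) {l..t}"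
      unfolding image using set_lebesgue_integral_eq_integral(1) has_integral_integrable_integral by blast
    have "((\<lambda>\<tau>. (\<psi> t - \<psi> \<tau>) powr (- \<alpha>) *\<^sub>R x' \<tau>)
        has_integral a * s powr (a - \<alpha>) * Beta a (1 - \<alpha>)) {l..t}"
    proof (rule has_integral_eq[OF _ has_integral_mult_right[OF int, of "a * s powr (a - \<alpha>)"]])
      fix \<tau> assume \<tau>: "\<tau> \<in> {l..t}"
      have p: "\<psi> \<tau> - \<psi> l \<ge> 0" "\<psi> t - \<psi> \<tau> \<ge> 0" "scale_deriv \<tau> > 0"
        using \<tau> scale_le[of l \<tau>] scale_le[of \<tau> t] scale_deriv_pos by auto
      have "1 - g \<tau> = (\<psi> t - \<psi> \<tau>) / s" using s by (simp add: g_def s_def field_simps)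
      then have "f (g \<tau>) = ((\<psi> \<tau> - \<psi> l) powr (a - 1) / s powr (a - 1)) *
          ((\<psi> t - \<psi> \<tau>) powr (- \<alpha>) / s powr (- \<alpha>))"
        using p s by (simp only: f_def g_def powr_divide)
      moreover have "s powr (a - \<alpha>) = s * s powr (a - 1) * s powr (- \<alpha>)"
        using s by (simp add: powr_diff powr_minus field_simps)
      ultimately show "a * s powr (a - \<alpha>) * (\<bar>scale_deriv \<tau> / s\<bar> * f (g \<tau>)) =
          (\<psi> t - \<psi> \<tau>) powr (- \<alpha>) *\<^sub>R x' \<tau>"
        using p s by (simp add: x'_def)
    qed
    moreover have "a * s powr (a - \<alpha>) * Beta a (1 - \<alpha>)
        = Gamma (1 - \<alpha>) *\<^sub>R (Gamma (a + 1) / Gamma (real j * \<alpha> + 1) * (s powr \<alpha>) ^ j)"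
    proof -
      have "a + (1 - \<alpha>) = real j * \<alpha> + 1" "a - \<alpha> = real j * \<alpha>"
        by (simp_all add: a_def algebra_simps)
      then show ?thesis using Ga power[OF s, of j] by (simp only: Beta_def) simp
    qed
    ultimately show ?thesis using False by simp
  qed
  then show ?thesis
    unfolding has_psi_Caputo_iff[OF assms(1,3)] using D
    by (intro exI[of _ x']) (simp only: a_def s_def, blast)
qed

text \<open>The partial sums solve the linear equation \<open>D W = c * W\<close> up to a shift of the index, since
  the derivative maps each term to \<open>c\<close> times the preceding one and annihilates the constant
  term.\<close>

lemma has_psi_Caputo_mittag_leffler_poly:
  assumes "l < t" "0 < \<alpha>" "\<alpha> \<le> 1"
  shows "has_psi_Caputo l \<psi> \<alpha>
    (\<lambda>\<tau>. mittag_leffler_poly \<alpha> (Suc n) (c * (\<psi> \<tau> - \<psi> l) powr \<alpha>))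
    (c * mittag_leffler_poly \<alpha> n (c * (\<psi> t - \<psi> l) powr \<alpha>)) t"
proof (induction n)
  case 0
  then show ?case
    using has_psi_Caputo_const[OF assms(1,3), of "1::real"] by (simp add: mittag_leffler_poly_def)
next
  case (Suc n)
  define b where "b = c ^ Suc n / Gamma (real (Suc n) * \<alpha> + 1)"
  have G: "Gamma (real (Suc n) * \<alpha> + 1) > 0"
    using assms by (intro Gamma_real_pos) (simp add: add_nonneg_pos)
  have "has_psi_Caputo l \<psi> \<alpha> (\<lambda>\<tau>. b * ((\<psi> \<tau> - \<psi> l) powr \<alpha>) ^ Suc n)
      (b * (Gamma (real (Suc n) * \<alpha> + 1) / Gamma (real n * \<alpha> + 1) * ((\<psi> t - \<psi> l) powr \<alpha>) ^ n)) t"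
    using assms by (intro has_psi_Caputo_linear[OF _ _ bounded_linear_mult_right] has_psi_Caputo_power) auto
  from has_psi_Caputo_add[OF assms(1,3) Suc this] show ?case
    using G by (simp add: mittag_leffler_poly_Suc[of \<alpha> "Suc n"] mittag_leffler_poly_Suc[of \<alpha> n] b_def
        power_mult_distrib distrib_left mult_ac del: of_nat_Suc)
qed

lemma continuous_on_mittag_leffler_poly:
  assumes "0 < \<alpha>"
  shows "continuous_on {l..} (\<lambda>\<tau>. mittag_leffler_poly \<alpha> n (c * (\<psi> \<tau> - \<psi> l) powr \<alpha>))"
proof -
  have "continuous_on {l..} (\<lambda>\<tau>. (\<psi> \<tau> - \<psi> l) powr \<alpha>)"
    using assms scale_le[of l] continuous_on_scale
    by (intro continuous_on_powr' continuous_intros) auto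
  moreover have "Gamma (real j * \<alpha> + 1) \<noteq> 0" for j
    using assms by (intro less_imp_neq[THEN not_sym] Gamma_real_pos) (simp add: add_nonneg_pos)
  ultimately show ?thesis
    unfolding mittag_leffler_poly_def by (intro continuous_on_sum continuous_on_divide continuous_on_power continuous_on_mult_left
        continuous_on_const) auto
qed

section \<open>Mittag-Leffler decay of dissipative fractional flows\<close>

text \<open>Write \<open>V t = (norm (z t - y))\<^sup>2\<close> and let \<open>W n\<close> be \<open>V l\<close> times the partial sum with \<open>n\<close>
  terms. Let \<open>V - W (n + 1)\<close> be maximal on \<open>{l..T}\<close> at \<open>s > l\<close>. The maximum principle is not
  applied to this difference but to the function \<open>h\<close> in which \<open>V\<close> is replaced by \<open>\<tau> \<mapsto> 2 * ((z
  s - y) \<bullet> z \<tau>)\<close>, which is linear in \<open>z\<close> and therefore has a known fractional derivative. By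
  convexity of the squared norm \<open>h s - h \<tau>\<close> is at least the drop of \<open>V - W (n + 1)\<close> from \<open>s\<close>
  to \<open>\<tau>\<close>, so \<open>s\<close> maximizes \<open>h\<close> too. The principle and the dissipation inequality give \<open>V s \<le> W
  n s\<close>, hence the maximum is at most the size of the last term of \<open>W (n + 1)\<close>.\<close>

lemma norm_decay_mittag_leffler_poly:
  fixes z :: "real \<Rightarrow> 'a::euclidean_space"
  assumes \<alpha>: "0 < \<alpha>" "\<alpha> \<le> 1" and "0 < c"
    and cont: "continuous_on {l..} z"
    and z: "\<And>t. l < t \<Longrightarrow> has_psi_Caputo l \<psi> \<alpha> z (G t) t"
    and dissipative: "\<And>t. l < t \<Longrightarrow> 2 * ((z t - y) \<bullet> G t) \<le> - c * (norm (z t - y))\<^sup>2"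
    and "l \<le> T"
  shows "(norm (z T - y))\<^sup>2 \<le> (norm (z l - y))\<^sup>2 *
    (mittag_leffler_poly \<alpha> (Suc n) (- c * (\<psi> T - \<psi> l) powr \<alpha>)
      + (c * (\<psi> T - \<psi> l) powr \<alpha>) ^ n / Gamma (real n * \<alpha> + 1))"
proof -
  define V where "V = (\<lambda>t. (norm (z t - y))\<^sup>2)"
  define W where "W = (\<lambda>n t. V l * mittag_leffler_poly \<alpha> n (- c * (\<psi> t - \<psi> l) powr \<alpha>))"
  define \<epsilon> where "\<epsilon> = V l * ((c * (\<psi> T - \<psi> l) powr \<alpha>) ^ n / Gamma (real n * \<alpha> + 1))"
  have V0: "V l \<ge> 0" by (simp add: V_def)
  have G: "Gamma (real n * \<alpha> + 1) > 0"
    using \<alpha> by (intro Gamma_real_pos) (simp add: add_nonneg_pos)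
  have \<epsilon>: "\<epsilon> \<ge> 0" using V0 G \<open>0 < c\<close> by (simp add: \<epsilon>_def)
  have contW: "continuous_on {l..} (W k)" for k
    unfolding W_def by (intro continuous_intros continuous_on_mittag_leffler_poly \<alpha>)
  have "continuous_on {l..} V" unfolding V_def by (intro continuous_intros cont)
  then have "continuous_on {l..} (\<lambda>t. V t - W (Suc n) t)"
    using contW by (rule continuous_on_diff)
  then have "continuous_on {l..T} (\<lambda>t. V t - W (Suc n) t)"
    by (rule continuous_on_subset) auto
  then obtain s where s: "s \<in> {l..T}"
    and max: "\<And>t. t \<in> {l..T} \<Longrightarrow> V t - W (Suc n) t \<le> V s - W (Suc n) s"
    using continuous_attains_sup[of "{l..T}" "\<lambda>t. V t - W (Suc n) t"] \<open>l \<le> T\<close> by auto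
  have "V s - W (Suc n) s \<le> \<epsilon>"
  proof (cases "s = l")
    case True
    then show ?thesis using \<epsilon> \<alpha> by (simp add: W_def mittag_leffler_poly_zero)
  next
    case False
    then have "l < s" using s by auto
    define h where "h = (\<lambda>\<tau>. (2 *\<^sub>R (z s - y)) \<bullet> z \<tau> +
        (- V l) * mittag_leffler_poly \<alpha> (Suc n) (- c * (\<psi> \<tau> - \<psi> l) powr \<alpha>))"
    have "has_psi_Caputo l \<psi> \<alpha> (\<lambda>\<tau>. (2 *\<^sub>R (z s - y)) \<bullet> z \<tau>) ((2 *\<^sub>R (z s - y)) \<bullet> G s) s"
      by (rule has_psi_Caputo_linear[OF \<open>l < s\<close> \<alpha>(2) bounded_linear_inner_right z[OF \<open>l < s\<close>]])
    moreover have "has_psi_Caputo l \<psi> \<alpha>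
        (\<lambda>\<tau>. (- V l) * mittag_leffler_poly \<alpha> (Suc n) (- c * (\<psi> \<tau> - \<psi> l) powr \<alpha>))
        ((- V l) * (- c * mittag_leffler_poly \<alpha> n (- c * (\<psi> s - \<psi> l) powr \<alpha>))) s"
      by (rule has_psi_Caputo_linear[OF \<open>l < s\<close> \<alpha>(2) bounded_linear_mult_right
            has_psi_Caputo_mittag_leffler_poly[OF \<open>l < s\<close> \<alpha>]])
    ultimately have "has_psi_Caputo l \<psi> \<alpha> h ((2 *\<^sub>R (z s - y)) \<bullet> G s +
        (- V l) * (- c * mittag_leffler_poly \<alpha> n (- c * (\<psi> s - \<psi> l) powr \<alpha>))) s"
      unfolding h_def by (rule has_psi_Caputo_add[OF \<open>l < s\<close> \<alpha>(2)])
    moreover have "continuous_on {l..s} h"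
      unfolding h_def
      by (intro continuous_intros continuous_on_subset[OF cont]
          continuous_on_subset[OF continuous_on_mittag_leffler_poly[OF \<alpha>(1)]]) auto
    moreover have "h \<tau> \<le> h s" if \<tau>: "\<tau> \<in> {l..s}" for \<tau>
    proof -
      have "V s - V \<tau> = 2 * ((z s - y) \<bullet> (z s - z \<tau>)) - (norm (z s - z \<tau>))\<^sup>2"
        by (simp add: V_def power2_norm_eq_inner inner_diff_left inner_diff_right inner_commute)
      also have "\<dots> \<le> 2 * ((z s - y) \<bullet> (z s - z \<tau>))" by simp
      also have "\<dots> = h s - h \<tau> + W (Suc n) s - W (Suc n) \<tau>"
        by (simp add: h_def W_def inner_diff_right algebra_simps)
      finally show ?thesis using max[of \<tau>] s \<tau> by simp
    qed
    ultimately have "0 \<le> 2 * ((z s - y) \<bullet> G s) + c * W n s"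
      using has_psi_Caputo_nonneg_at_max[OF \<open>l < s\<close> \<alpha>, of h] by (simp add: W_def mult_ac)
    then have le: "c * V s \<le> c * W n s" using dissipative[OF \<open>l < s\<close>] by (simp add: V_def)
    then have "V s \<le> W n s" using le \<open>0 < c\<close> by simp
    then have "V s - W (Suc n) s \<le> W n s - W (Suc n) s" by simp
    also have "\<dots> = V l * (- ((- c * (\<psi> s - \<psi> l) powr \<alpha>) ^ n) / Gamma (real n * \<alpha> + 1))"
      by (simp add: W_def mittag_leffler_poly_Suc algebra_simps)
    also have "\<dots> \<le> \<epsilon>"
    proof -
      have "- ((- c * (\<psi> s - \<psi> l) powr \<alpha>) ^ n) \<le> \<bar>- c * (\<psi> s - \<psi> l) powr \<alpha>\<bar> ^ n"
        by (metis abs_ge_minus_self power_abs)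
      also have "\<dots> \<le> (c * (\<psi> T - \<psi> l) powr \<alpha>) ^ n"
        using \<open>0 < c\<close> s \<alpha> scale_le[of l s] scale_le[of s T]
        by (intro power_mono) (auto simp: abs_mult intro!: mult_left_mono powr_mono2)
      finally show ?thesis unfolding \<epsilon>_def
        using V0 G by (intro mult_left_mono divide_right_mono) auto
    qed
    finally show ?thesis .
  qed
  then show ?thesis
    using max[of T] \<open>l \<le> T\<close> by (simp add: V_def W_def \<epsilon>_def distrib_left)
qed

text \<open>The last term in the bound for the partial sums is a term of a convergent series and
  disappears in the limit.\<close>

lemma norm_decay_mittag_leffler:
  fixes z :: "real \<Rightarrow> 'a::euclidean_space"
  assumes \<alpha>: "0 < \<alpha>" "\<alpha> \<le> 1" and "0 < c"
    and "continuous_on {l..} z"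
    and "\<And>t. l < t \<Longrightarrow> has_psi_Caputo l \<psi> \<alpha> z (G t) t"
    and "\<And>t. l < t \<Longrightarrow> 2 * ((z t - y) \<bullet> G t) \<le> - c * (norm (z t - y))\<^sup>2"
    and "l \<le> T"
  shows "(norm (z T - y))\<^sup>2 \<le> (norm (z l - y))\<^sup>2 * mittag_leffler \<alpha> (- c * (\<psi> T - \<psi> l) powr \<alpha>)"
proof (rule LIMSEQ_le_const)
  let ?w = "c * (\<psi> T - \<psi> l) powr \<alpha>"
  have "(\<lambda>n. mittag_leffler_poly \<alpha> (Suc n) (- ?w) + ?w ^ n / Gamma (real n * \<alpha> + 1))
      \<longlonglongrightarrow> mittag_leffler \<alpha> (- ?w) + 0"
    by (intro tendsto_add LIMSEQ_Suc mittag_leffler_poly_tendsto summable_LIMSEQ_zero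
        summable_mittag_leffler \<alpha>)
  then show "(\<lambda>n. (norm (z l - y))\<^sup>2 * (mittag_leffler_poly \<alpha> (Suc n) (- c * (\<psi> T - \<psi> l) powr \<alpha>)
      + ?w ^ n / Gamma (real n * \<alpha> + 1)))
      \<longlonglongrightarrow> (norm (z l - y))\<^sup>2 * mittag_leffler \<alpha> (- c * (\<psi> T - \<psi> l) powr \<alpha>)"
    by (intro tendsto_mult_left) simp
  show "\<exists>N. \<forall>n\<ge>N. (norm (z T - y))\<^sup>2 \<le> (norm (z l - y))\<^sup>2 *
      (mittag_leffler_poly \<alpha> (Suc n) (- c * (\<psi> T - \<psi> l) powr \<alpha>) + ?w ^ n / Gamma (real n * \<alpha> + 1))"
    using norm_decay_mittag_leffler_poly[OF assms] by blast
qed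

end

section \<open>Fractional gradient flows of strongly convex functions\<close>

theorem theorem5p2:
  fixes \<alpha> \<beta> l m_f :: real
    and f :: "real ^ 'd \<Rightarrow> real"
    and \<psi> :: "real \<Rightarrow> real"
    and z :: "real \<Rightarrow> real ^ 'd"
    and z0 ystar :: "real ^ 'd"
  assumes "0 < \<alpha>" and "\<alpha> \<le> 1" and "0 \<le> l" and "0 < \<beta>"
    and "class_C2 f"
    and "0 < m_f" and "\<And>x. matrix_le (m_f *\<^sub>R mat 1) (hessian f x)"
    and "gradient f ystar = 0"
    and "\<psi> ` {l..} \<subseteq> {0..}"
    and "strict_mono_on {l..} \<psi>"
    and "\<psi> differentiable_on {l..}"
    and "continuous_on {l..} (half_line_deriv l \<psi>)"
    and "\<And>t. l \<le> t \<Longrightarrow> 0 < half_line_deriv l \<psi> t"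
    and "fractional_gradient_flow l \<psi> \<alpha> \<beta> f z0 z"
  shows "(\<forall>t\<ge>l. (norm (z t - ystar))\<^sup>2
             \<le> (norm (z0 - ystar))\<^sup>2 * mittag_leffler \<alpha> (- \<beta> * m_f * (\<psi> t - \<psi> l) powr \<alpha>)) \<and>
         (\<forall>L_f>0. (\<forall>x y. norm (gradient f x - gradient f y) \<le> L_f * norm (x - y)) \<longrightarrow>
           (\<forall>t\<ge>l. f (z t) - f ystar
             \<le> 1 / 2 * L_f * (norm (z0 - ystar))\<^sup>2
                 * mittag_leffler \<alpha> (- \<beta> * m_f * (\<psi> t - \<psi> l) powr \<alpha>)))"
proof -
  interpret time_scale l \<psi> using assms by unfold_locales auto
  have diff: "f differentiable_on UNIV" "gradient f differentiable_on UNIV"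
    using \<open>class_C2 f\<close> by (auto simp: class_C2_def)
  have flow: "continuous_on {l..} z" "z l = z0"
      "\<And>t. l < t \<Longrightarrow> has_psi_Caputo l \<psi> \<alpha> z (- \<beta> *\<^sub>R gradient f (z t)) t"
    using assms(14) by (auto simp: fractional_gradient_flow_def)
  have "2 * ((z t - ystar) \<bullet> (- \<beta> *\<^sub>R gradient f (z t))) \<le> - (\<beta> * m_f) * (norm (z t - ystar))\<^sup>2" for t
  proof -
    have mono: "m_f * (norm (z t - ystar))\<^sup>2 \<le> (z t - ystar) \<bullet> gradient f (z t)"
      using strongly_monotone_gradient[OF diff(2) assms(7), of "z t" ystar] assms(8)
      by (simp add: inner_commute)
    \<comment> \<open>The dissipation is twice as strong as the claimed rate \<open>\<beta> * m_f\<close> requires.\<close>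
    have "0 \<le> m_f * (norm (z t - ystar))\<^sup>2" using \<open>0 < m_f\<close> by simp
    with mono have "m_f * (norm (z t - ystar))\<^sup>2 \<le> 2 * ((z t - ystar) \<bullet> gradient f (z t))" by linarith
    from mult_left_mono[OF this, of \<beta>] show ?thesis using \<open>0 < \<beta>\<close> by (simp add: mult_ac)
  qed
  then have decay: "(norm (z t - ystar))\<^sup>2
      \<le> (norm (z0 - ystar))\<^sup>2 * mittag_leffler \<alpha> (- \<beta> * m_f * (\<psi> t - \<psi> l) powr \<alpha>)" if "l \<le> t" for t
    using norm_decay_mittag_leffler[OF assms(1,2) _ flow(1,3), of "\<beta> * m_f" ystar t]
      that flow(2) \<open>0 < \<beta>\<close> \<open>0 < m_f\<close> by simp
  show ?thesis
  proof (intro conjI allI impI)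
    fix L t :: real
    assume L: "0 < L" "\<forall>x y. norm (gradient f x - gradient f y) \<le> L * norm (x - y)" and t: "l \<le> t"
    have "f (z t) - f ystar \<le> 1 / 2 * L * (norm (z t - ystar))\<^sup>2"
      using L(2) by (intro descent_lemma_at_critical_point diff assms) auto
    also have "\<dots> \<le> 1 / 2 * L * ((norm (z0 - ystar))\<^sup>2 *
        mittag_leffler \<alpha> (- \<beta> * m_f * (\<psi> t - \<psi> l) powr \<alpha>))"
      using L(1) by (intro mult_left_mono decay t) simp
    finally show "f (z t) - f ystar \<le> 1 / 2 * L * (norm (z0 - ystar))\<^sup>2
        * mittag_leffler \<alpha> (- \<beta> * m_f * (\<psi> t - \<psi> l) powr \<alpha>)"
      by (simp only: mult.assoc)
  qed (rule decay)
qed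

end
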